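(* Let $D\subsetneq\mathbb{R}^d$ $(d\geq3)$ be a convex domain. Then $$\delta_D^{(1)}(x,v)=\delta_D^{(d-1)}(x,v)\qquad\text{for all } x\in D,\ v\in\mathbb{R}^d$$ if and only if $D$ is either (1) a Euclidean ball; (2) a half-space; or (3) a slab.
   Context: A domain is a connected (nonempty) open set. For $k\in\{1,\dots,d\}$, $x\in D$ and $v\in\mathbb{R}^d$, $$\delta_D^{(k)}(x,v):=\sup\{d_{Euc}(x,(x+V)\cap\partial D): V\subseteq\mathbb{R}^d\text{ a $k$-dimensional linear subspace with } v\in V\},$$ where $d_{Euc}(x,A)=\inf_{a\in A}\|x-a\|$ is the Euclidean distance, with value $+\infty$ if $A=\varnothing$. A half-space is a domain of the form $\{x\in\mathbb{R}^d:\langle x-a,w\rangle<0\}$, and a slab is a domain of the form $\{x\in\mathbb{R}^d:|\langle x-a,w\rangle|<1\}$, where $a\in\mathbb{R}^d$ and $w\in\mathbb{R}^d\setminus\{0\}$. Euclidean balls are open balls of arbitrary center and radius $r>0$. *)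

theory Defs
  imports "HOL-Analysis.Analysis"
begin

definition is_domain :: "'a::euclidean_space set \<Rightarrow> bool" where
  "is_domain D \<longleftrightarrow> open D \<and> connected D \<and> D \<noteq> {}"

text \<open>Extended-real valued, because \<^const>\<open>infdist\<close> is \<open>0\<close> on the empty set, whereas here
  the distance to the empty set is \<open>\<infinity>\<close> (the infimum of the empty set in \<^typ>\<open>ereal\<close>).\<close>

definition dist_Euc :: "'a::euclidean_space \<Rightarrow> 'a set \<Rightarrow> ereal" where
  "dist_Euc x A = (INF a\<in>A. ereal (norm (x - a)))"

text \<open>Meant for \<open>1 \<le> k \<le> DIM('a)\<close>; the supremum is then over a nonempty family.\<close>

definition bdry_delta :: "'a::euclidean_space set \<Rightarrow> nat \<Rightarrow> 'a \<Rightarrow> 'a \<Rightarrow> ereal" where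
  "bdry_delta D k x v =
     (SUP V\<in>{V. subspace V \<and> dim V = k \<and> v \<in> V}. dist_Euc x ((+) x ` V \<inter> frontier D))"

definition is_ball :: "'a::euclidean_space set \<Rightarrow> bool" where
  "is_ball D \<longleftrightarrow> (\<exists>c r. r > 0 \<and> D = ball c r)"

definition is_half_space :: "'a::euclidean_space set \<Rightarrow> bool" where
  "is_half_space D \<longleftrightarrow> (\<exists>a w. w \<noteq> 0 \<and> D = {x. (x - a) \<bullet> w < 0})"

definition is_slab :: "'a::euclidean_space set \<Rightarrow> bool" where
  "is_slab D \<longleftrightarrow> (\<exists>a w. w \<noteq> 0 \<and> D = {x. \<bar>(x - a) \<bullet> w\<bar> < 1})"

end

theory Submission
  imports Defs
begin

text \<open>
  Write \<open>d\<close> for the dimension. In terms of \<open>D\<close>, the equality of the two boundary distances at \<open>x\<close>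
  and \<open>v \<noteq> 0\<close> says that an open segment in direction \<open>v\<close> with midpoint \<open>x\<close> inside \<open>D\<close> is always a
  diameter of a \<open>(d - 1)\<close>-dimensional disc inside \<open>D\<close>.

  That balls, half-spaces and slabs have this property is shown in one stroke: seen from \<open>x\<close>, they are
  rotationally symmetric about some vector \<open>w\<close>, and the hyperplane that contains \<open>v\<close> and is
  orthogonal to the component of \<open>w\<close> perpendicular to \<open>v\<close> contains the disc
  (\<open>bdry_delta_eq_if_round\<close>).

  For the converse, take the disc over a chord from \<open>p\<close> to \<open>q\<close>, which lies in the hyperplane with
  normal \<open>n\<close>. It touches the supporting hyperplanes of \<open>D\<close> at \<open>p\<close> and at \<open>q\<close>, so every outer
  normal at these points lies in the plane spanned by \<open>p - q\<close> and \<open>n\<close>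
  (\<open>chord_normals_in_span\<close>). As \<open>d \<ge> 3\<close>, varying the chord shows that a boundary point has only
  one outer normal (\<open>outer_normal_unique\<close>), and then that any two normal lines of the boundary are
  coplanar (\<open>outer_normals_coplanar\<close>). Pairwise coplanar lines are all parallel, all in one plane,
  or all concurrent. Parallel normals mean a half-space or a slab. Normals that
  all lie in one plane, but are not all parallel, would make \<open>D\<close> invariant under translations
  orthogonal to that plane, and normal lines at different heights of such a cylinder are coplanar
  only if they are parallel.

  There remains the case that all normal lines pass through a point \<open>c\<close>. Then \<open>c\<close> lies in \<open>D\<close>, and
  the supporting hyperplane at each boundary point is orthogonal to the radius from \<open>c\<close>
  (\<open>radial_normals_outward\<close>). Therefore the distance from \<open>c\<close> to the boundary, as a function of
  the direction, changes only to second order, hence not at all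
  (\<open>const_on_sphere_if_cos_bound\<close>), and \<open>D\<close> is a ball.
\<close>

section \<open>Boundary distances along lines and hyperplanes\<close>

lemma ray_exit:
  fixes D :: "'a::euclidean_space set"
  assumes "open D" "x \<in> D" "y \<notin> D"
  obtains t where "0 < t" "t \<le> 1" "x + t *\<^sub>R (y - x) \<in> frontier D"
proof -
  have "closed_segment x y \<inter> frontier D \<noteq> {}"
    using assms by (intro connected_Int_frontier) auto
  then obtain p where p: "p \<in> closed_segment x y" "p \<in> frontier D" by auto
  then obtain t where t: "0 \<le> t" "t \<le> 1" "p = x + t *\<^sub>R (y - x)"
    by (auto simp: in_segment algebra_simps)
  have "p \<notin> D" using p(2) assms(1) by (simp add: frontier_def interior_open)
  then have "t \<noteq> 0" using t assms(2) by auto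
  then show thesis using t p(2) by (intro that[of t]) auto
qed

lemma le_dist_Euc:
  fixes D :: "'a::euclidean_space set"
  assumes "open D" and "\<And>u. u \<in> V \<Longrightarrow> ereal (norm u) < R \<Longrightarrow> x + u \<in> D"
  shows "R \<le> dist_Euc x ((+) x ` V \<inter> frontier D)"
  unfolding dist_Euc_def
proof (rule INF_greatest)
  fix a assume a: "a \<in> (+) x ` V \<inter> frontier D"
  then obtain u where u: "u \<in> V" "a = x + u" by auto
  have "a \<notin> D" using a assms(1) by (simp add: frontier_def interior_open)
  then show "R \<le> ereal (norm (x - a))" using assms(2)[OF u(1)] u by force
qed

text \<open>Walking from \<open>x\<close> towards a point of \<open>x + V\<close> outside \<open>D\<close>, one meets the boundary, still inside
  \<open>x + V\<close> and no further away. Together with the preceding lemma this turns the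
  distance to \<open>(x + V) \<inter> frontier D\<close> into a statement about balls of \<open>x + V\<close> that lie in \<open>D\<close>.\<close>
lemma dist_Euc_lower_bound_imp_mem:
  fixes D :: "'a::euclidean_space set"
  assumes "open D" "x \<in> D" "subspace V" "u \<in> V"
    and "ereal (norm u) < dist_Euc x ((+) x ` V \<inter> frontier D)"
  shows "x + u \<in> D"
proof (rule ccontr)
  assume "x + u \<notin> D"
  then obtain t where t: "0 < t" "t \<le> 1" "x + t *\<^sub>R u \<in> frontier D"
    using ray_exit[OF assms(1,2), of "x + u"] by auto
  have "t *\<^sub>R u \<in> V" using assms by (simp add: subspace_scale)
  then have "x + t *\<^sub>R u \<in> (+) x ` V \<inter> frontier D" using t by auto
  then have "dist_Euc x ((+) x ` V \<inter> frontier D) \<le> ereal (norm (x - (x + t *\<^sub>R u)))"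
    unfolding dist_Euc_def by (rule INF_lower)
  also have "\<dots> \<le> ereal (norm u)" using t mult_right_mono[of t 1 "norm u"] by simp
  finally show False using assms(5) by simp
qed

lemma dist_Euc_antimono: "A \<subseteq> B \<Longrightarrow> dist_Euc x B \<le> dist_Euc x A"
  unfolding dist_Euc_def by (rule INF_superset_mono) auto

lemma subspace_one_dim_eq_span:
  fixes L :: "'a::euclidean_space set"
  assumes "subspace L" "dim L = 1"
  obtains u where "u \<noteq> 0" "L = span {u}"
proof -
  obtain u where u: "u \<in> L" "u \<noteq> 0"
    using assms dim_eq_0[of L] by force
  have "span {u} = L"
    using u assms by (intro subspace_dim_equal) (auto intro: span_minimal[THEN subsetD])
  then show thesis using that u by auto
qed

text \<open>The hyperplane orthogonal to the component of \<open>w\<close> perpendicular to \<open>u\<close> works: on it, \<open>w\<close>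
  acts as a multiple of \<open>u\<close>, so by Cauchy-Schwarz a vector of given length has the largest
  inner product with \<open>w\<close> when it points along \<open>u\<close>.\<close>
lemma hyperplane_along_line_shrinking_inner:
  fixes u w :: "'a::euclidean_space"
  assumes "2 \<le> DIM('a)" "u \<noteq> 0"
  obtains V where "subspace V" "dim V = DIM('a) - 1" "u \<in> V"
    "\<And>y. y \<in> V \<Longrightarrow> \<bar>w \<bullet> y\<bar> \<le> \<bar>w \<bullet> ((norm y / norm u) *\<^sub>R u)\<bar>"
proof -
  define k where "k = (w \<bullet> u) / (u \<bullet> u)"
  have perp: "(w - k *\<^sub>R u) \<bullet> u = 0" using assms by (simp add: k_def inner_diff_left)
  obtain n where n: "n \<noteq> 0" "n \<bullet> u = 0" "\<And>y. n \<bullet> y = 0 \<Longrightarrow> (w - k *\<^sub>R u) \<bullet> y = 0"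
  proof (cases "w - k *\<^sub>R u = 0")
    case True
    obtain n where "n \<noteq> 0" "orthogonal u n" using orthogonal_to_vector_exists[OF assms(1)] by blast
    then show thesis using that[of n] True by (simp add: orthogonal_def inner_commute)
  next
    case False then show thesis using that[of "w - k *\<^sub>R u"] perp by auto
  qed
  show thesis
  proof
    show "subspace {y. n \<bullet> y = 0}" by (rule subspace_hyperplane)
    show "dim {y. n \<bullet> y = 0} = DIM('a) - 1" by (rule dim_hyperplane[OF n(1)])
    show "u \<in> {y. n \<bullet> y = 0}" using n by simp
    fix y assume "y \<in> {y. n \<bullet> y = 0}"
    then have "w \<bullet> y = k * (u \<bullet> y)" using n(3)[of y] by (simp add: inner_diff_left)
    then have "\<bar>w \<bullet> y\<bar> = \<bar>k\<bar> * \<bar>u \<bullet> y\<bar>" by (simp add: abs_mult)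
    also have "\<dots> \<le> \<bar>k\<bar> * (norm u * norm y)"
      by (intro mult_left_mono Cauchy_Schwarz_ineq2) auto
    also have "\<dots> = \<bar>w \<bullet> ((norm y / norm u) *\<^sub>R u)\<bar>"
      using assms by (simp add: k_def abs_mult power2_norm_eq_inner[symmetric] power2_eq_square)
    finally show "\<bar>w \<bullet> y\<bar> \<le> \<bar>w \<bullet> ((norm y / norm u) *\<^sub>R u)\<bar>" .
  qed
qed

text \<open>What balls, half-spaces and slabs have in common: whether \<open>x + y\<close> belongs to \<open>D\<close> depends
  only on \<open>norm y\<close> and \<open>w \<bullet> y\<close>, and for a fixed norm the admissible values of \<open>w \<bullet> y\<close> form an
  interval. Such an interval contains \<open>w \<bullet> y\<close> as soon as it contains \<open>w \<bullet> z\<close> and \<open>- (w \<bullet> z)\<close> with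
  \<open>\<bar>w \<bullet> y\<bar> \<le> \<bar>w \<bullet> z\<bar>\<close>.\<close>
definition round_from :: "'a::euclidean_space set \<Rightarrow> 'a \<Rightarrow> 'a \<Rightarrow> bool" where
  "round_from D x w \<longleftrightarrow> (\<forall>y z. norm z = norm y \<longrightarrow> \<bar>w \<bullet> y\<bar> \<le> \<bar>w \<bullet> z\<bar> \<longrightarrow>
     x + z \<in> D \<longrightarrow> x - z \<in> D \<longrightarrow> x + y \<in> D)"

lemma round_from_ball: "round_from (ball c r) x (c - x)"
  unfolding round_from_def
proof (intro allI impI)
  fix y z :: 'a
  assume h: "norm z = norm y" "\<bar>(c - x) \<bullet> y\<bar> \<le> \<bar>(c - x) \<bullet> z\<bar>" "x + z \<in> ball c r" "x - z \<in> ball c r"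
  have sq: "(norm (c - (x + u)))\<^sup>2 = (norm (c - x))\<^sup>2 - 2 * ((c - x) \<bullet> u) + (norm u)\<^sup>2" for u
    unfolding power2_norm_eq_inner by (simp add: algebra_simps inner_commute)
  have "norm (c - (x + z)) < r" "norm (c - (x + - z)) < r" using h by (auto simp: dist_norm)
  then have r: "0 \<le> r" "(norm (c - (x + z)))\<^sup>2 < r\<^sup>2" "(norm (c - (x + - z)))\<^sup>2 < r\<^sup>2"
    using norm_ge_zero[of "c - (x + z)"] by (linarith, auto intro!: power_strict_mono)
  then have "(norm (c - (x + y)))\<^sup>2 < r\<^sup>2" using h(1,2) unfolding sq by auto
  then show "x + y \<in> ball c r" using r(1) by (simp add: dist_norm power_less_imp_less_base)
qed

lemma round_from_half_space: "round_from {x. (x - a) \<bullet> w < 0} x w"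
  unfolding round_from_def by (auto simp: algebra_simps inner_commute)

lemma round_from_slab: "round_from {x. \<bar>(x - a) \<bullet> w\<bar> < 1} x w"
  unfolding round_from_def by (auto simp: algebra_simps inner_commute)

text \<open>For \<open>v = 0\<close> as well, every hyperplane through \<open>v\<close> contains a line through \<open>v\<close>, and fewer
  boundary points are met on the line.\<close>
lemma bdry_delta_antimono_hyperplane_line:
  fixes D :: "'a::euclidean_space set"
  assumes "2 \<le> DIM('a)"
  shows "bdry_delta D (DIM('a) - 1) x v \<le> bdry_delta D 1 x v"
  unfolding bdry_delta_def
proof (rule SUP_mono)
  fix V :: "'a set" assume "V \<in> {V. subspace V \<and> dim V = DIM('a) - 1 \<and> v \<in> V}"
  then have V: "subspace V" "dim V = DIM('a) - 1" "v \<in> V" by auto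
  obtain u where u: "u \<in> V" "u \<noteq> 0" "v \<in> span {u}"
  proof (cases "v = 0")
    case True
    have "\<not> V \<subseteq> {0}" using V assms dim_eq_0[of V] by auto
    then show thesis using that True by (auto simp: span_zero)
  next
    case False then show thesis using that[of v] V by (auto simp: span_base)
  qed
  show "\<exists>L\<in>{V. subspace V \<and> dim V = 1 \<and> v \<in> V}.
      dist_Euc x ((+) x ` V \<inter> frontier D) \<le> dist_Euc x ((+) x ` L \<inter> frontier D)"
  proof
    show "span {u} \<in> {V. subspace V \<and> dim V = 1 \<and> v \<in> V}" using u by simp
    have "span {u} \<subseteq> V" using u V by (simp add: span_minimal)
    then show "dist_Euc x ((+) x ` V \<inter> frontier D) \<le> dist_Euc x ((+) x ` span {u} \<inter> frontier D)"
      by (intro dist_Euc_antimono) auto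
  qed
qed

text \<open>A line through \<open>x\<close> is extended to the hyperplane that shrinks inner products with \<open>w\<close>; a point
  \<open>x + y\<close> of it is then compared with the two points of the line at the same distance from \<open>x\<close>.\<close>
lemma bdry_delta_eq_if_round:
  fixes D :: "'a::euclidean_space set"
  assumes dim: "2 \<le> DIM('a)" and "open D" "x \<in> D" and round: "round_from D x w"
  shows "bdry_delta D 1 x v = bdry_delta D (DIM('a) - 1) x v"
proof (rule antisym)
  show "bdry_delta D 1 x v \<le> bdry_delta D (DIM('a) - 1) x v"
    unfolding bdry_delta_def
  proof (rule SUP_mono)
    fix L :: "'a set" assume "L \<in> {V. subspace V \<and> dim V = 1 \<and> v \<in> V}"
    then have L: "subspace L" "dim L = 1" "v \<in> L" by auto
    obtain u where u: "u \<noteq> 0" "L = span {u}" using subspace_one_dim_eq_span L by blast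
    obtain V where V: "subspace V" "dim V = DIM('a) - 1" "u \<in> V"
      "\<And>y. y \<in> V \<Longrightarrow> \<bar>w \<bullet> y\<bar> \<le> \<bar>w \<bullet> ((norm y / norm u) *\<^sub>R u)\<bar>"
      using hyperplane_along_line_shrinking_inner[OF dim u(1), of w] by blast
    show "\<exists>V\<in>{V. subspace V \<and> dim V = DIM('a) - 1 \<and> v \<in> V}.
      dist_Euc x ((+) x ` L \<inter> frontier D) \<le> dist_Euc x ((+) x ` V \<inter> frontier D)"
    proof
      have "L \<subseteq> V" using u V by (simp add: span_minimal)
      then show "V \<in> {V. subspace V \<and> dim V = DIM('a) - 1 \<and> v \<in> V}" using V L by auto
      show "dist_Euc x ((+) x ` L \<inter> frontier D) \<le> dist_Euc x ((+) x ` V \<inter> frontier D)"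
      proof (rule le_dist_Euc[OF \<open>open D\<close>])
        fix y assume y: "y \<in> V" "ereal (norm y) < dist_Euc x ((+) x ` L \<inter> frontier D)"
        define z where "z = (norm y / norm u) *\<^sub>R u"
        have z: "norm z = norm y" "z \<in> L" "- z \<in> L"
          using u by (simp_all add: z_def span_base span_scale span_neg)
        then have "x + z \<in> D" "x + - z \<in> D"
          using y assms(2,3) L(1) by (auto intro!: dist_Euc_lower_bound_imp_mem simp del: add_uminus_conv_diff)
        then show "x + y \<in> D"
          using round V(4)[OF y(1)] z unfolding round_from_def z_def[symmetric] by auto
      qed
    qed
  qed
  show "bdry_delta D (DIM('a) - 1) x v \<le> bdry_delta D 1 x v"
    using bdry_delta_antimono_hyperplane_line[OF dim] .
qed

text \<open>The equality of the two suprema gives, for each radius below \<open>R\<close>, a hyperplane disc inside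
  \<open>D\<close>; by compactness of the unit sphere their normals accumulate at a normal that serves the
  radius \<open>R\<close> itself. In the limit the disc is only seen to lie in the closure of \<open>D\<close>, which is
  enough for a comparison with supporting hyperplanes.\<close>
lemma hyperplane_disc_if_bdry_delta_eq:
  fixes D :: "'a::euclidean_space set"
  assumes dim: "2 \<le> DIM('a)" and "open D" "x \<in> D" "v \<noteq> 0" "0 < R"
    and eq: "bdry_delta D 1 x v = bdry_delta D (DIM('a) - 1) x v"
    and line: "\<And>t. norm (t *\<^sub>R v) < R \<Longrightarrow> x + t *\<^sub>R v \<in> D"
  obtains n where "norm n = 1" "n \<bullet> v = 0"
    "\<And>u. n \<bullet> u = 0 \<Longrightarrow> norm u < R \<Longrightarrow> x + u \<in> closure D"
proof -
  have "ereal R \<le> dist_Euc x ((+) x ` span {v} \<inter> frontier D)"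
    using line by (intro le_dist_Euc[OF \<open>open D\<close>]) (auto simp: span_singleton)
  also have "\<dots> \<le> bdry_delta D 1 x v"
    unfolding bdry_delta_def using \<open>v \<noteq> 0\<close> by (intro SUP_upper) (auto simp: span_base)
  finally have big: "ereal R \<le> bdry_delta D (DIM('a) - 1) x v" using eq by simp
  have "\<exists>n. norm n = 1 \<and> n \<bullet> v = 0 \<and> (\<forall>u. n \<bullet> u = 0 \<longrightarrow> norm u < R' \<longrightarrow> x + u \<in> D)"
    if "R' < R" for R'
  proof -
    have "ereal R' < bdry_delta D (DIM('a) - 1) x v"
      using less_le_trans[OF _ big, of "ereal R'"] that by simp
    then obtain V where V: "subspace V" "dim V = DIM('a) - 1" "v \<in> V"
      and VR: "ereal R' < dist_Euc x ((+) x ` V \<inter> frontier D)"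
      unfolding bdry_delta_def less_SUP_iff by auto
    obtain a where a: "a \<noteq> 0" "V = {y. a \<bullet> y = 0}"
      using lowdim_eq_hyperplane[OF V(2)] V(1) by (metis span_eq_iff)
    have "x + u \<in> D" if "a \<bullet> u = 0" "norm u < R'" for u
    proof -
      have "ereal (norm u) < dist_Euc x ((+) x ` V \<inter> frontier D)"
        using that(2) by (intro less_trans[OF _ VR]) simp
      then show ?thesis using that(1) a V(1) assms(2,3) by (intro dist_Euc_lower_bound_imp_mem) auto
    qed
    then show ?thesis using a V(3) by (intro exI[of _ "sgn a"]) (auto simp: norm_sgn sgn_div_norm)
  qed
  then have "\<exists>n. norm n = 1 \<and> n \<bullet> v = 0 \<and>
      (\<forall>u. n \<bullet> u = 0 \<longrightarrow> norm u < R - 1 / real (Suc k) \<longrightarrow> x + u \<in> D)" for k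
    by simp
  then obtain n where n: "\<And>k. norm (n k) = 1" "\<And>k. n k \<bullet> v = 0"
    "\<And>k u. n k \<bullet> u = 0 \<Longrightarrow> norm u < R - 1 / real (Suc k) \<Longrightarrow> x + u \<in> D"
    by metis
  obtain m \<sigma> where m: "m \<in> sphere 0 1" "strict_mono \<sigma>" "(n \<circ> \<sigma>) \<longlonglongrightarrow> m"
    using compact_imp_seq_compact[OF compact_sphere, of 0 1] n(1)
    unfolding seq_compact_def by (metis mem_sphere_0)
  have nm: "(\<lambda>k. n (\<sigma> k)) \<longlonglongrightarrow> m" using m(3) by (simp add: o_def)
  show thesis
  proof
    show "norm m = 1" using m by simp
    have "(\<lambda>k. n (\<sigma> k) \<bullet> v) \<longlonglongrightarrow> m \<bullet> v" by (intro tendsto_intros nm)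
    then show "m \<bullet> v = 0" using n(2) by (simp add: LIMSEQ_const_iff)
    \<comment> \<open>A vector orthogonal to the limit normal \<open>m\<close> is the limit of its own orthogonal projections
      onto the approximating hyperplanes, and projecting does not lengthen it.\<close>
    fix u assume u: "m \<bullet> u = 0" "norm u < R"
    define f where "f k = u - (n (\<sigma> k) \<bullet> u) *\<^sub>R n (\<sigma> k)" for k
    have "f \<longlonglongrightarrow> u - (m \<bullet> u) *\<^sub>R m" unfolding f_def by (intro tendsto_intros nm)
    then have lim: "(\<lambda>k. x + f k) \<longlonglongrightarrow> x + u" using u by (intro tendsto_intros) simp
    have perp: "n (\<sigma> k) \<bullet> f k = 0" for k
      using n(1)[of "\<sigma> k"] by (simp add: f_def inner_diff_right norm_eq_1)
    have norm: "norm (f k) \<le> norm u" for k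
    proof -
      have "u = f k + (n (\<sigma> k) \<bullet> u) *\<^sub>R n (\<sigma> k)" by (simp add: f_def)
      then have "(norm u)\<^sup>2 = (norm (f k))\<^sup>2 + (norm ((n (\<sigma> k) \<bullet> u) *\<^sub>R n (\<sigma> k)))\<^sup>2"
        using perp[of k] by (metis norm_add_Pythagorean orthogonal_def inner_commute inner_scaleR_left mult_zero_right)
      then have "(norm (f k))\<^sup>2 \<le> (norm u)\<^sup>2" by simp
      then show ?thesis by (rule power2_le_imp_le) simp
    qed
    have "(\<lambda>k. R - 1 / real (Suc (\<sigma> k))) \<longlonglongrightarrow> R - 0"
      using LIMSEQ_subseq_LIMSEQ[OF LIMSEQ_inverse_real_of_nat m(2)]
      by (intro tendsto_intros) (simp add: o_def divide_inverse)
    then have "eventually (\<lambda>k. norm u < R - 1 / real (Suc (\<sigma> k))) sequentially"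
      using u(2) by (intro order_tendstoD(1)) auto
    then have "eventually (\<lambda>k. x + f k \<in> closure D) sequentially"
      by eventually_elim (meson closure_subset le_less_trans n(3) norm perp subsetD)
    then show "x + u \<in> closure D"
      using lim by (intro Lim_in_closed_set[of "closure D"]) auto
  qed
qed

section \<open>Outer normals of convex domains\<close>

text \<open>The strict inequality is the right one for an open set; it forces \<open>p \<notin> D\<close>.\<close>
definition outer_normal :: "'a::euclidean_space set \<Rightarrow> 'a \<Rightarrow> 'a \<Rightarrow> bool" where
  "outer_normal D p n \<longleftrightarrow> norm n = 1 \<and> (\<forall>y\<in>D. (y - p) \<bullet> n < 0)"

lemma outer_normal_norm: "outer_normal D p n \<Longrightarrow> norm n = 1"
  and outer_normal_less: "outer_normal D p n \<Longrightarrow> y \<in> D \<Longrightarrow> (y - p) \<bullet> n < 0"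
  by (auto simp: outer_normal_def)

lemma outer_normal_le:
  assumes "outer_normal D p n" "y \<in> closure D"
  shows "(y - p) \<bullet> n \<le> 0"
proof -
  have "closure D \<subseteq> {y. n \<bullet> y \<le> n \<bullet> p}"
  proof (intro closure_minimal closed_halfspace_le subsetI CollectI)
    fix y assume "y \<in> D"
    then have "(y - p) \<bullet> n < 0" using assms(1) by (simp add: outer_normal_def)
    then show "n \<bullet> y \<le> n \<bullet> p" by (simp add: inner_diff_left inner_diff_right inner_commute[of _ n])
  qed
  then show ?thesis using assms(2) by (auto simp: inner_diff_left inner_diff_right inner_commute[of _ n])
qed

lemma outer_normal_frontier:
  assumes "outer_normal D p n" "p \<in> closure D" "open D"
  shows "p \<in> frontier D"
  using assms by (auto simp: frontier_def interior_open outer_normal_def)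

lemma exists_outer_normal:
  fixes D :: "'a::euclidean_space set"
  assumes "open D" "convex D" "p \<in> frontier D"
  obtains n where "outer_normal D p n"
proof -
  have D: "interior (closure D) = D" "p \<in> closure D" "p \<notin> D"
    using assms by (auto simp: convex_interior_closure interior_open frontier_def)
  have "D \<noteq> {}" using assms(3) by auto
  then have ri: "rel_interior (closure D) = D"
    using D(1) by (metis assms(1,2) rel_interior_open convex_rel_interior_closure)
  obtain a where a: "a \<noteq> 0" "\<And>y. y \<in> D \<Longrightarrow> a \<bullet> p < a \<bullet> y"
    using supporting_hyperplane_rel_boundary[of "closure D" p] D ri assms(2) by (metis convex_closure)
  have "outer_normal D p (- sgn a)"
    unfolding outer_normal_def
  proof (intro conjI ballI)
    fix y assume "y \<in> D"
    from a(2)[OF this] have "0 < (y - p) \<bullet> a" by (simp add: inner_diff_left inner_diff_right inner_commute[of _ a])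
    then show "(y - p) \<bullet> - sgn a < 0" using a(1) by (simp add: sgn_div_norm)
  qed (use a in \<open>simp add: norm_sgn\<close>)
  then show thesis by (rule that)
qed

text \<open>A segment leaving \<open>D\<close> crosses the boundary outwards: its direction makes an acute angle with
  the outer normal at the exit point, because the starting point is inside.\<close>
lemma exit_outer_normal:
  fixes D :: "'a::euclidean_space set"
  assumes "open D" "convex D" "x \<in> D" "y \<notin> D"
  obtains t e where "0 < t" "t \<le> 1" "x + t *\<^sub>R (y - x) \<in> frontier D"
    "outer_normal D (x + t *\<^sub>R (y - x)) e" "0 < (y - x) \<bullet> e" "0 \<le> (y - (x + t *\<^sub>R (y - x))) \<bullet> e"
proof -
  obtain t where t: "0 < t" "t \<le> 1" "x + t *\<^sub>R (y - x) \<in> frontier D"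
    using ray_exit assms by blast
  obtain e where e: "outer_normal D (x + t *\<^sub>R (y - x)) e"
    using exists_outer_normal t assms by blast
  have "(x - (x + t *\<^sub>R (y - x))) \<bullet> e < 0" by (rule outer_normal_less[OF e assms(3)])
  then have "0 < t * ((y - x) \<bullet> e)" by simp
  then have pos: "0 < (y - x) \<bullet> e" using t by (simp add: zero_less_mult_iff)
  have "y - (x + t *\<^sub>R (y - x)) = (1 - t) *\<^sub>R (y - x)" by (simp add: algebra_simps)
  then have "0 \<le> (y - (x + t *\<^sub>R (y - x))) \<bullet> e" using pos t by simp
  then show thesis using that t e pos by blast
qed

lemma separating_outer_normal:
  fixes D :: "'a::euclidean_space set"
  assumes "open D" "convex D" "D \<noteq> {}" "y \<notin> D"
  obtains p e where "p \<in> frontier D" "outer_normal D p e" "0 \<le> (y - p) \<bullet> e"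
proof -
  obtain x where "x \<in> D" using assms(3) by auto
  then show thesis using that exit_outer_normal[OF assms(1,2) _ assms(4)] by blast
qed

lemma in_span_2: "x \<in> span {a, b} \<longleftrightarrow> (\<exists>s t. x = s *\<^sub>R a + t *\<^sub>R b)"
proof
  assume "x \<in> span {a, b}"
  then obtain s where "x - s *\<^sub>R a \<in> span {b}" by (auto simp: span_breakdown_eq)
  then obtain t where "x - s *\<^sub>R a = t *\<^sub>R b" unfolding span_singleton by blast
  then have "x = s *\<^sub>R a + t *\<^sub>R b" by (simp add: algebra_simps)
  then show "\<exists>s t. x = s *\<^sub>R a + t *\<^sub>R b" by blast
qed (auto simp: span_add span_scale span_base)

lemma unit_notin_span:
  assumes "norm a = 1" "norm b = 1" "a \<noteq> b" "a \<noteq> - b"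
  shows "a \<notin> span {b}"
proof
  assume "a \<in> span {b}"
  then obtain k where k: "a = k *\<^sub>R b" by (auto simp: span_singleton)
  then have "\<bar>k\<bar> = 1" using assms by simp
  then show False using k assms by (auto simp: abs_if split: if_splits)
qed

lemma midpoint_eq_shrink: "midpoint p y = p - (1/2) *\<^sub>R (p - y)" for p y :: "'a::real_vector"
proof -
  have "(1/2) *\<^sub>R p + (1/2) *\<^sub>R p = p" by (simp flip: scaleR_add_left)
  then have "p - (1/2) *\<^sub>R p = (1/2) *\<^sub>R p" by (simp add: diff_eq_eq)
  then show ?thesis by (simp add: midpoint_def scaleR_diff_right scaleR_add_right diff_diff_eq2 add_diff_eq diff_add_eq)
qed

lemma dim_span_pair:
  fixes a b :: "'a::euclidean_space"
  assumes "a \<notin> span {b}" "b \<noteq> 0"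
  shows "dim {a, b} = 2"
  using assms by (simp add: dim_insert)

text \<open>The span of two vectors has dimension at most two, so it is spanned by any two independent vectors
  in it.\<close>
lemma span_pair_exchange:
  fixes a b v n :: "'a::euclidean_space"
  assumes "a \<in> span {v, n}" "b \<in> span {v, n}" "a \<notin> span {b}" "b \<noteq> 0"
  shows "v \<in> span {a, b}"
proof -
  have "span {a, b} = span {v, n}"
  proof (rule subspace_dim_equal)
    show "span {a, b} \<subseteq> span {v, n}" using assms by (intro span_minimal) auto
    have "dim {v, n} \<le> card {v, n}" by (intro dim_le_card) (auto simp: span_superset)
    also have "\<dots> \<le> 2" by (simp add: card_insert_if)
    finally show "dim (span {v, n}) \<le> dim (span {a, b})" using dim_span_pair[OF assms(3,4)] by simp
  qed auto
  then show ?thesis by (simp add: span_base)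
qed

lemma exists_orthogonal_to_pair:
  fixes a b :: "'a::euclidean_space"
  assumes "3 \<le> DIM('a)"
  obtains w where "w \<noteq> 0" "\<And>y. y \<in> span {a, b} \<Longrightarrow> w \<bullet> y = 0"
proof -
  have "dim {a, b} \<le> card {a, b}" by (intro dim_le_card) (auto simp: span_superset)
  also have "\<dots> \<le> 2" by (simp add: card_insert_if)
  finally have "dim {a, b} < DIM('a)" using assms by simp
  then show thesis using orthogonal_to_subspace_exists that unfolding orthogonal_def by metis
qed

lemma open_not_in_hyperplane:
  fixes D :: "'a::euclidean_space set"
  assumes "open D" "D \<noteq> {}" "w \<noteq> 0"
  obtains y where "y \<in> D" "(y - p) \<bullet> w \<noteq> 0"
proof -
  obtain x where x: "x \<in> D" using assms by auto
  then obtain e where e: "e > 0" "cball x e \<subseteq> D" using assms(1) open_contains_cball by blast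
  have "x + (e / norm w) *\<^sub>R w \<in> D" using e assms(3) by (intro subsetD[OF e(2)]) (simp add: dist_norm)
  moreover have "(x + (e / norm w) *\<^sub>R w - p) \<bullet> w \<noteq> (x - p) \<bullet> w"
    using e assms(3) by (simp add: inner_diff_left inner_add_left)
  ultimately show thesis using that x by metis
qed

section \<open>Smoothness and pairwise coplanar normal lines\<close>

text \<open>A disc of radius \<open>norm v\<close> in the hyperplane orthogonal to \<open>n\<close> that stays below the
  supporting hyperplane with normal \<open>m\<close> touches it at \<open>v\<close>. Hence the linear form given by \<open>m\<close> is
  largest on the disc at \<open>v\<close>, which by the equality case of Cauchy-Schwarz makes the orthogonal
  projection of \<open>m\<close> to the hyperplane a multiple of \<open>v\<close>.\<close>
lemma disc_normal_in_span:
  fixes v n m :: "'a::euclidean_space"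
  assumes "v \<noteq> 0" "norm n = 1" "n \<bullet> v = 0"
    and disc: "\<And>u. n \<bullet> u = 0 \<Longrightarrow> norm u < norm v \<Longrightarrow> u \<bullet> m \<le> v \<bullet> m"
  shows "m \<in> span {v, n}"
proof -
  define w where "w = m - (n \<bullet> m) *\<^sub>R n"
  have nw: "n \<bullet> w = 0" using assms(2) by (simp add: w_def inner_diff_right norm_eq_1)
  have m: "m = w + (n \<bullet> m) *\<^sub>R n" by (simp add: w_def)
  have vw: "v \<bullet> m = v \<bullet> w" using assms(3) by (simp add: w_def inner_diff_right inner_commute)
  have "norm v * norm w \<le> v \<bullet> w"
  \<comment> \<open>The disc is open, so the vector of length \<open>norm v\<close> along \<open>w\<close> is only approached.\<close>
  proof (rule field_le_mult_one_interval)
    fix s :: real assume s: "0 < s" "s < 1"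
    show "s * (norm v * norm w) \<le> v \<bullet> w"
    proof (cases "w = 0")
      case False
      define u where "u = (s * norm v / norm w) *\<^sub>R w"
      have "n \<bullet> u = 0" using nw by (simp add: u_def)
      moreover have "norm u < norm v" using s False assms(1) by (simp add: u_def)
      ultimately have "u \<bullet> m \<le> v \<bullet> w" using disc[of u] vw by simp
      moreover have "u \<bullet> m = s * (norm v * norm w)"
      proof -
        have "w \<bullet> m = (norm w)\<^sup>2"
          by (subst m) (simp add: inner_add_right inner_commute[of w n] nw power2_norm_eq_inner)
        then show ?thesis using False by (simp add: u_def power2_eq_square)
      qed
      ultimately show ?thesis by simp
    qed simp
  qed
  then have "v \<bullet> w = norm v * norm w" using norm_cauchy_schwarz[of v w] by simp
  then have "norm v *\<^sub>R w = norm w *\<^sub>R v" by (simp add: norm_cauchy_schwarz_eq)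
  then have "w = (norm w / norm v) *\<^sub>R v"
    using assms(1) by (simp add: vector_fraction_eq_iff eq_vector_fraction_iff)
  then show ?thesis unfolding in_span_2 using m by metis
qed

text \<open>The geometric content of the equality of the two boundary distances: an open segment of \<open>D\<close>
  centred at \<open>x\<close> is a diameter of a disc of codimension one that does not leave the closure of
  \<open>D\<close>.\<close>
definition disc_domain :: "'a::euclidean_space set \<Rightarrow> bool" where
  "disc_domain D \<longleftrightarrow> 3 \<le> DIM('a) \<and> open D \<and> convex D \<and> D \<noteq> {} \<and>
     (\<forall>x\<in>D. \<forall>v R. v \<noteq> 0 \<longrightarrow> 0 < R \<longrightarrow> (\<forall>t. norm (t *\<^sub>R v) < R \<longrightarrow> x + t *\<^sub>R v \<in> D) \<longrightarrow>
       (\<exists>n. norm n = 1 \<and> n \<bullet> v = 0 \<and> (\<forall>u. n \<bullet> u = 0 \<longrightarrow> norm u < R \<longrightarrow> x + u \<in> closure D)))"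

lemma disc_domain_D:
  fixes D :: "'a::euclidean_space set"
  assumes "disc_domain D"
  shows disc_domain_dim: "3 \<le> DIM('a)" and disc_domain_open: "open D"
    and disc_domain_convex: "convex D" and disc_domain_nonempty: "D \<noteq> {}"
    and disc_domain_disc: "\<lbrakk>x \<in> D; v \<noteq> 0; 0 < R; \<And>t. norm (t *\<^sub>R v) < R \<Longrightarrow> x + t *\<^sub>R v \<in> D\<rbrakk>
      \<Longrightarrow> \<exists>n. norm n = 1 \<and> n \<bullet> v = 0 \<and> (\<forall>u. n \<bullet> u = 0 \<longrightarrow> norm u < R \<longrightarrow> x + u \<in> closure D)"
  using assms unfolding disc_domain_def by blast+

text \<open>The disc around the midpoint of the chord, with the half chord as radius, touches the
  supporting hyperplanes at both ends. The chord may also end at a point \<open>q\<close> inside \<open>D\<close>, where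
  there are no outer normals; that case gives the uniqueness of the normal at \<open>p\<close>.\<close>
lemma chord_normals_in_span:
  assumes dd: "disc_domain D" and "p \<in> closure D" "q \<in> closure D" "midpoint p q \<in> D" "p \<noteq> q"
  obtains n where "\<And>m. outer_normal D p m \<Longrightarrow> m \<in> span {p - q, n}"
    "\<And>m. outer_normal D q m \<Longrightarrow> m \<in> span {p - q, n}"
proof -
  note op = disc_domain_open[OF dd] and conv = disc_domain_convex[OF dd]
  define x v where "x = midpoint p q" and "v = (1/2) *\<^sub>R (p - q)"
  have pq: "p = x + v" "q = x - v" "v \<noteq> 0"
    using assms(5) by (auto simp: x_def v_def midpoint_def algebra_simps simp flip: scaleR_add_left)
  have x: "x \<in> interior D" using assms(4) op by (simp add: x_def interior_open)
  have "x + t *\<^sub>R v \<in> D" if "norm (t *\<^sub>R v) < norm v" for t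
  proof -
    have t: "\<bar>t\<bar> < 1" using that pq(3) by simp
    have pos: "x + s *\<^sub>R y \<in> D" if "x + y \<in> closure D" "0 < s" "s < 1" for s y
    proof -
      have "x + s *\<^sub>R y \<in> interior D"
        using mem_interior_closure_convex_shrink[OF conv x that(1), of "1 - s"] that(2,3)
        by (simp add: algebra_simps)
      then show ?thesis using interior_subset by blast
    qed
    consider "t = 0" | "0 < t" | "t < 0" by linarith
    then show ?thesis
    proof cases
      case 1 then show ?thesis using assms(4) by (simp add: x_def)
    next
      case 2 then show ?thesis using pos[of v t] t assms(2,3) pq by simp
    next
      case 3 then show ?thesis using pos[of "- v" "- t"] t assms(2,3) pq by simp
    qed
  qed
  then obtain n where n: "norm n = 1" "n \<bullet> v = 0"
    "\<And>u. n \<bullet> u = 0 \<Longrightarrow> norm u < norm v \<Longrightarrow> x + u \<in> closure D"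
    using disc_domain_disc[OF dd, of x v "norm v"] assms(4) pq(3) x_def by auto
  have sp: "span {v, n} \<subseteq> span {p - q, n}" "span {- v, n} \<subseteq> span {p - q, n}"
    by (intro span_minimal; auto simp: v_def span_scale span_neg span_base)+
  have "m \<in> span {p - q, n}" if m: "outer_normal D p m" for m
  proof -
    have "u \<bullet> m \<le> v \<bullet> m" if "n \<bullet> u = 0" "norm u < norm v" for u
      using outer_normal_le[OF m n(3)[OF that]] pq by (simp add: algebra_simps)
    then show ?thesis using disc_normal_in_span[OF pq(3) n(1,2)] sp(1) by blast
  qed
  moreover have "m \<in> span {p - q, n}" if m: "outer_normal D q m" for m
  proof -
    have "u \<bullet> m \<le> (- v) \<bullet> m" if "n \<bullet> u = 0" "norm u < norm (- v)" for u
      using outer_normal_le[OF m n(3)[OF that(1)]] that(2) pq by (simp add: algebra_simps)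
    then show ?thesis using disc_normal_in_span[of "- v" n m] pq(3) n(1,2) sp(2) by auto
  qed
  ultimately show thesis by (rule that)
qed

lemma outer_normal_neq_uminus:
  assumes dd: "disc_domain D" and "outer_normal D p m" "outer_normal D p m'"
  shows "m \<noteq> - m'"
proof -
  note nonempty = disc_domain_nonempty[OF dd]
  obtain y where "y \<in> D" using nonempty by auto
  then have "(y - p) \<bullet> m < 0" "(y - p) \<bullet> m' < 0" using assms(2,3) outer_normal_less by blast+
  then show ?thesis by auto
qed

text \<open>Two independent normals at \<open>p\<close> would span a plane that, by \<open>chord_normals_in_span\<close>, contains
  \<open>p - y\<close> for all \<open>y \<in> D\<close>. An open set does not fit into a plane when the dimension is at least
  three.\<close>
lemma outer_normal_unique:
  assumes dd: "disc_domain D" and "p \<in> frontier D" and m: "outer_normal D p m" "outer_normal D p m'"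
  shows "m = m'"
proof (rule ccontr)
  note dim3 = disc_domain_dim[OF dd] and op = disc_domain_open[OF dd]
    and conv = disc_domain_convex[OF dd] and nonempty = disc_domain_nonempty[OF dd]
  assume "m \<noteq> m'"
  then have ind: "m \<notin> span {m'}"
    using unit_notin_span outer_normal_norm outer_normal_neq_uminus[OF dd] m by metis
  have m'0: "m' \<noteq> 0" using m outer_normal_norm by force
  have p: "p \<in> closure D" "p \<notin> D" using assms(2) op by (auto simp: frontier_def interior_open)
  obtain w where w: "w \<noteq> 0" "\<And>y. y \<in> span {m, m'} \<Longrightarrow> w \<bullet> y = 0"
    using exists_orthogonal_to_pair[OF dim3] by blast
  obtain y where y: "y \<in> D" "(y - p) \<bullet> w \<noteq> 0"
    using open_not_in_hyperplane[OF op nonempty w(1)] by blast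
  have "midpoint p y \<in> interior D"
    using mem_interior_closure_convex_shrink[OF conv _ p(1), of y "1/2"] y(1) op
    by (simp add: interior_open midpoint_eq_shrink)
  then have mid: "midpoint p y \<in> D" using interior_subset by blast
  have "y \<in> closure D" "p \<noteq> y" using y p closure_subset by auto
  then obtain n where "\<And>m. outer_normal D p m \<Longrightarrow> m \<in> span {p - y, n}"
    using chord_normals_in_span[OF dd p(1) _ mid] by metis
  then have "p - y \<in> span {m, m'}" using m ind m'0 span_pair_exchange by blast
  then have "w \<bullet> (p - y) = 0" by (rule w(2))
  then show False using y(2) by (simp add: inner_diff_right inner_diff_left inner_commute[of _ w])
qed

text \<open>The lines through \<open>p\<close> and \<open>q\<close> in the directions of their normals lie in a common plane. If
  the chord runs through \<open>D\<close>, both normals lie in a span of two vectors one of which is \<open>p - q\<close>.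
  Otherwise the whole chord lies in one face of the boundary, and by uniqueness the two normals
  agree.\<close>
lemma outer_normals_coplanar:
  assumes dd: "disc_domain D" and "p \<in> frontier D" "outer_normal D p a" "q \<in> frontier D" "outer_normal D q b"
    and ab: "a \<notin> span {b}"
  shows "p - q \<in> span {a, b}"
proof -
  note op = disc_domain_open[OF dd] and conv = disc_domain_convex[OF dd]
  have pq: "p \<in> closure D" "q \<in> closure D" using assms by (auto simp: frontier_def)
  have b0: "b \<noteq> 0" using assms outer_normal_norm by force
  show ?thesis
  proof (cases "midpoint p q \<in> D")
    case True
    show ?thesis
    proof (cases "p = q")
      case False
      then show ?thesis
        using chord_normals_in_span[OF dd pq True] span_pair_exchange assms(3,5) ab b0 by metis
    qed (simp add: span_zero)
  next
    case False
    define x where "x = midpoint p q"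
    have "x \<in> closure D"
      using pq conv convex_closure midpoint_in_closed_segment closed_segment_subset x_def by blast
    then have "x \<in> frontier D" using False op by (simp add: x_def frontier_def interior_open)
    then obtain e where e: "outer_normal D x e" using exists_outer_normal op conv by blast
    have "(p - x) \<bullet> e \<le> 0" "(q - x) \<bullet> e \<le> 0" using outer_normal_le[OF e] pq by auto
    moreover have "(p - x) + (q - x) = 0" by (simp add: x_def midpoint_def algebra_simps flip: scaleR_add_left)
    then have "(p - x) \<bullet> e + (q - x) \<bullet> e = 0" by (metis inner_add_left inner_zero_left)
    ultimately have "p \<bullet> e = x \<bullet> e" "q \<bullet> e = x \<bullet> e" by (auto simp: inner_diff_left)
    then have "outer_normal D p e" "outer_normal D q e"
      using e by (auto simp: outer_normal_def inner_diff_left)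
    then have "a = b" using outer_normal_unique[OF dd] assms by metis
    then show ?thesis using ab by (simp add: span_base)
  qed
qed

section \<open>Parallel or concurrent normal lines\<close>

text \<open>All boundary points with the same normal lie in the same supporting hyperplane, so \<open>D\<close> is
  the intersection of one or two half-spaces.\<close>
lemma parallel_outer_normals_imp_half_space_or_slab:
  fixes D :: "'a::euclidean_space set"
  assumes op: "open D" and conv: "convex D" and ne: "D \<noteq> {}"
    and p: "p \<in> frontier D" and n: "outer_normal D p n"
    and par: "\<And>q m. q \<in> frontier D \<Longrightarrow> outer_normal D q m \<Longrightarrow> m = n \<or> m = - n"
  shows "is_half_space D \<or> is_slab D"
proof -
  have n0: "n \<noteq> 0" using outer_normal_norm[OF n] by auto
  have fc: "q \<in> closure D" if "q \<in> frontier D" for q using that by (simp add: frontier_def)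
  have same: "(q - p) \<bullet> n = 0" if "q \<in> frontier D" "outer_normal D q n" for q
    using outer_normal_le[OF n fc[OF that(1)]] outer_normal_le[OF that(2) fc[OF p]]
    by (simp add: inner_diff_left)
  show ?thesis
  proof (cases "\<exists>q\<in>frontier D. outer_normal D q (- n)")
    case False
    have "y \<in> D" if "(y - p) \<bullet> n < 0" for y
    proof (rule ccontr)
      assume "y \<notin> D"
      then obtain q e where q: "q \<in> frontier D" "outer_normal D q e" "0 \<le> (y - q) \<bullet> e"
        using separating_outer_normal[OF op conv ne] by blast
      then have "e = n" using par False by blast
      then show False using q that same[of q] by (simp add: inner_diff_left)
    qed
    then have "D = {y. (y - p) \<bullet> n < 0}" using outer_normal_less[OF n] by blast
    then show ?thesis using n0 unfolding is_half_space_def by blast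
  next
    case True
    then obtain q where q: "q \<in> frontier D" "outer_normal D q (- n)" by blast
    have same': "(r - q) \<bullet> n = 0" if "r \<in> frontier D" "outer_normal D r (- n)" for r
      using outer_normal_le[OF q(2) fc[OF that(1)]] outer_normal_le[OF that(2) fc[OF q(1)]]
      by (simp add: inner_diff_left)
    define l where "l = (p - q) \<bullet> n"
    obtain x where "x \<in> D" using ne by auto
    then have l: "0 < l"
      using outer_normal_less[OF n, of x] outer_normal_less[OF q(2), of x]
      by (simp add: l_def inner_diff_left)
    have D: "D = {y. (y - p) \<bullet> n < 0 \<and> 0 < (y - q) \<bullet> n}"
    proof (intro equalityI subsetI CollectI)
      fix y assume y: "y \<in> {y. (y - p) \<bullet> n < 0 \<and> 0 < (y - q) \<bullet> n}"
      show "y \<in> D"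
      proof (rule ccontr)
        assume "y \<notin> D"
        then obtain r e where r: "r \<in> frontier D" "outer_normal D r e" "0 \<le> (y - r) \<bullet> e"
          using separating_outer_normal[OF op conv ne] by blast
        consider "e = n" | "e = - n" using par r by blast
        then show False
          by cases (use r y same[of r] same'[of r] in \<open>auto simp: inner_diff_left\<close>)
      qed
    qed (use outer_normal_less[OF n] outer_normal_less[OF q(2)] in fastforce)
    \<comment> \<open>The width of the slab is \<open>l\<close>; the vector \<open>(2 / l) *\<^sub>R n\<close> makes the inner product run from
      \<open>-1\<close> at \<open>q\<close> to \<open>1\<close> at \<open>p\<close>.\<close>
    have mid: "(y - midpoint p q) \<bullet> ((2 / l) *\<^sub>R n) = 2 * ((y - p) \<bullet> n) / l + 1"
      "(y - midpoint p q) \<bullet> ((2 / l) *\<^sub>R n) = 2 * ((y - q) \<bullet> n) / l - 1" for y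
      using l by (auto simp: l_def midpoint_def inner_diff_left inner_add_left field_simps)
    have "D = {y. \<bar>(y - midpoint p q) \<bullet> ((2 / l) *\<^sub>R n)\<bar> < 1}"
    proof -
      have "\<bar>(y - midpoint p q) \<bullet> ((2 / l) *\<^sub>R n)\<bar> < 1 \<longleftrightarrow> (y - p) \<bullet> n < 0 \<and> 0 < (y - q) \<bullet> n" for y
      proof -
        have "(y - midpoint p q) \<bullet> ((2 / l) *\<^sub>R n) < 1 \<longleftrightarrow> (y - p) \<bullet> n < 0"
          unfolding mid(1) using l by (simp add: divide_less_0_iff)
        moreover have "- 1 < (y - midpoint p q) \<bullet> ((2 / l) *\<^sub>R n) \<longleftrightarrow> 0 < (y - q) \<bullet> n"
          unfolding mid(2) using l by (simp add: zero_less_divide_iff)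
        ultimately show ?thesis unfolding abs_less_iff by linarith
      qed
      then show ?thesis unfolding D by blast
    qed
    moreover have "(2 / l) *\<^sub>R n \<noteq> 0" using l n0 by simp
    ultimately show ?thesis unfolding is_slab_def by blast
  qed
qed

text \<open>Lines in independent directions \<open>a\<close>, \<open>b\<close>, \<open>e\<close> that are pairwise coplanar: the point \<open>c\<close>
  common to the first two lies in both planes that contain the third line, and these planes intersect
  in that line only.\<close>
lemma three_lines_concurrent:
  fixes a b e :: "'a::euclidean_space"
  assumes "c - p \<in> span {a}" "c - q \<in> span {b}" "p - r \<in> span {a, e}" "q - r \<in> span {b, e}"
    and "a \<notin> span {b}" "e \<notin> span {a, b}"
  shows "c - r \<in> span {e}"
proof -
  have "(c - p) + (p - r) \<in> span {a, e}"
    using assms(1,3) span_mono[of "{a}" "{a, e}"] by (intro span_add) auto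
  moreover have "(c - q) + (q - r) \<in> span {b, e}"
    using assms(2,4) span_mono[of "{b}" "{b, e}"] by (intro span_add) auto
  ultimately obtain s t s' t' where
    c: "c - r = s *\<^sub>R a + t *\<^sub>R e" "c - r = s' *\<^sub>R b + t' *\<^sub>R e"
    unfolding in_span_2 by auto
  then have eq: "(t' - t) *\<^sub>R e = s *\<^sub>R a + (- s') *\<^sub>R b" by (simp add: algebra_simps)
  have "t' = t"
  proof (rule ccontr)
    assume "t' \<noteq> t"
    then have "e = (1 / (t' - t)) *\<^sub>R ((t' - t) *\<^sub>R e)" by simp
    also have "\<dots> \<in> span {a, b}" unfolding eq
      by (intro span_scale) (use in_span_2 in blast)
    finally show False using assms(6) by simp
  qed
  have "s = 0"
  proof (rule ccontr)
    assume s: "s \<noteq> 0"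
    have "s *\<^sub>R a = s' *\<^sub>R b" using eq \<open>t' = t\<close> by simp
    then have "a = (s' / s) *\<^sub>R b" using s by (metis scaleR_scaleR divide_inverse_commute left_inverse scaleR_one)
    then have "a \<in> span {b}" by (simp only: span_scale span_base singletonI)
    then show False using assms(5) by simp
  qed
  then have "c - r = t *\<^sub>R e" using c(1) by simp
  then show ?thesis by (simp only: span_scale span_base singletonI)
qed

lemma notin_span_swap: "a \<notin> span {b} \<Longrightarrow> b \<noteq> 0 \<Longrightarrow> b \<notin> span {a}"
  for a b :: "'a::real_vector"
  using in_span_insert[of b a "{}"] by auto

text \<open>If all normals were in the plane spanned by \<open>a\<close> and \<open>b\<close>, then \<open>D\<close> would be invariant under
  translation by a vector \<open>w\<close> orthogonal to it. The normal lines at \<open>p + w\<close> and \<open>q\<close> would have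
  to be coplanar like those at \<open>p\<close> and \<open>q\<close>, which puts \<open>w\<close> into the plane.\<close>
lemma exists_third_normal:
  assumes dd: "disc_domain D"
    and p: "p \<in> frontier D" "outer_normal D p a" and q: "q \<in> frontier D" "outer_normal D q b"
    and ab: "a \<notin> span {b}"
  obtains r e where "r \<in> frontier D" "outer_normal D r e" "e \<notin> span {a, b}"
proof (rule ccontr)
  note dim3 = disc_domain_dim[OF dd] and op = disc_domain_open[OF dd]
    and conv = disc_domain_convex[OF dd] and nonempty = disc_domain_nonempty[OF dd]
  assume no: "\<not> thesis"
  have planar: "e \<in> span {a, b}" if "r \<in> frontier D" "outer_normal D r e" for r e
    using that \<open>\<And>r e. r \<in> frontier D \<Longrightarrow> outer_normal D r e \<Longrightarrow> e \<notin> span {a, b} \<Longrightarrow> thesis\<close> no by blast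
  obtain w where w: "w \<noteq> 0" "\<And>y. y \<in> span {a, b} \<Longrightarrow> w \<bullet> y = 0"
    using exists_orthogonal_to_pair[OF dim3] by blast
  have "y + w \<in> D" if "y \<in> D" for y
  proof (rule ccontr)
    assume "y + w \<notin> D"
    then obtain r e where r: "r \<in> frontier D" "outer_normal D r e" "0 \<le> (y + w - r) \<bullet> e"
      using separating_outer_normal[OF op conv nonempty] by blast
    then show False using outer_normal_less[OF r(2) that] w(2)[OF planar[OF r(1,2)]]
      by (simp add: inner_diff_left inner_add_left)
  qed
  then have "(+) w ` D \<subseteq> D" by (auto simp: add.commute)
  then have "(+) w ` closure D \<subseteq> closure D"
    using closure_mono closure_translation by metis
  then have cl: "p + w \<in> closure D" using p(1) by (auto simp: frontier_def add.commute)
  have wab: "w \<bullet> a = 0" using w(2) by (simp add: span_base)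
  then have on: "outer_normal D (p + w) a"
    using p(2) by (simp add: outer_normal_def inner_diff_left inner_add_left)
  have "(p + w) - q \<in> span {a, b}"
    using outer_normals_coplanar[OF dd outer_normal_frontier[OF on cl op] on q ab] .
  moreover have "p - q \<in> span {a, b}" by (rule outer_normals_coplanar[OF dd p q ab])
  ultimately have "((p + w) - q) - (p - q) \<in> span {a, b}" by (rule span_diff)
  then have "w \<bullet> w = 0" by (intro w(2)) simp
  then show False using w(1) by simp
qed

text \<open>The classical fact that pairwise coplanar lines, not all parallel and not all in directions of
  one plane, pass through a common point: two of them meet in \<open>c\<close>, a third independent one passes
  through \<open>c\<close>, and any further line is independent of two of these three.\<close>
lemma normal_lines_concurrent:
  assumes dd: "disc_domain D"
    and p: "p \<in> frontier D" "outer_normal D p a" and q: "q \<in> frontier D" "outer_normal D q b"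
    and ab: "a \<notin> span {b}"
  obtains c where "\<And>r e. r \<in> frontier D \<Longrightarrow> outer_normal D r e \<Longrightarrow> c - r \<in> span {e}"
proof -
  have nz: "e \<noteq> 0" if "outer_normal D r e" for r e using outer_normal_norm[OF that] by auto
  obtain s t where "p - q = s *\<^sub>R a + t *\<^sub>R b"
    using outer_normals_coplanar[OF dd p q ab] unfolding in_span_2 by blast
  define c where "c = p - s *\<^sub>R a"
  have "c - p = - s *\<^sub>R a" "c - q = t *\<^sub>R b"
    using \<open>p - q = _\<close> by (auto simp: c_def algebra_simps)
  then have cp: "c - p \<in> span {a}" and cq: "c - q \<in> span {b}"
    by (simp_all only: span_base span_scale singletonI)
  have third: "c - r' \<in> span {e'}"
    if "p' \<in> frontier D" "outer_normal D p' a'" "q' \<in> frontier D" "outer_normal D q' b'"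
      "r' \<in> frontier D" "outer_normal D r' e'" "c - p' \<in> span {a'}" "c - q' \<in> span {b'}"
      "a' \<notin> span {b'}" "e' \<notin> span {a', b'}" for p' a' q' b' r' e'
  proof -
    have "e' \<notin> span {a'}" "e' \<notin> span {b'}"
      using that(10) span_mono[of "{a'}" "{a', b'}"] span_mono[of "{b'}" "{a', b'}"] by auto
    then have "a' \<notin> span {e'}" "b' \<notin> span {e'}" using notin_span_swap nz that by metis+
    then show ?thesis
      using three_lines_concurrent[OF that(7,8) _ _ that(9,10)] outer_normals_coplanar[OF dd] that by blast
  qed
  obtain r f where r: "r \<in> frontier D" "outer_normal D r f" "f \<notin> span {a, b}"
    using exists_third_normal[OF dd p q ab] .
  have cr: "c - r \<in> span {f}" using third[OF p q r(1,2) cp cq ab r(3)] .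
  show thesis
  proof
    fix x e assume x: "x \<in> frontier D" "outer_normal D x e"
    show "c - x \<in> span {e}"
    proof (cases "e \<in> span {a, b}")
      case False
      then show ?thesis using third[OF p q x cp cq ab] by blast
    next
      case True
      then obtain \<alpha> \<beta> where e: "e = \<alpha> *\<^sub>R a + \<beta> *\<^sub>R b" unfolding in_span_2 by blast
      have fab: "f \<notin> span {a}" "f \<notin> span {b}"
        using r(3) span_mono[of "{a}" "{a, b}"] span_mono[of "{b}" "{a, b}"] by auto
      have only: "e \<in> span {g}" if gf: "e \<in> span {g, f}" "g \<in> {a, b}" for g
      proof -
        obtain s t where st: "e = s *\<^sub>R g + t *\<^sub>R f" using gf(1) unfolding in_span_2 by blast
        have "t = 0"
        proof (rule ccontr)
          assume t: "t \<noteq> 0"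
          have "t *\<^sub>R f = e - s *\<^sub>R g" using st by simp
          also have "\<dots> \<in> span {a, b}"
            using True gf(2) by (intro span_diff span_scale) (auto simp: span_base)
          finally have "(1 / t) *\<^sub>R (t *\<^sub>R f) \<in> span {a, b}" by (rule span_scale)
          then show False using t r(3) by simp
        qed
        then have "e = s *\<^sub>R g" using st by simp
        then show ?thesis by (simp only: span_scale span_base singletonI)
      qed
      consider "e \<notin> span {a, f}" | "e \<notin> span {b, f}" | "e \<in> span {a}" "e \<in> span {b}"
        using only by blast
      then show ?thesis
      proof cases
        case 1
        have "a \<notin> span {f}" using fab(1) notin_span_swap nz p by metis
        then show ?thesis using third[OF p r(1,2) x cp cr _ 1] by blast
      next
        case 2
        have "b \<notin> span {f}" using fab(2) notin_span_swap nz q by metis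
        then show ?thesis using third[OF q r(1,2) x cq cr _ 2] by blast
      next
        case 3
        have "a \<in> span {e}" using 3(1) notin_span_swap nz[OF x(2)] nz[OF p(2)] by metis
        then have "a \<in> span {b}" using span_minimal[of "{e}" "span {b}"] 3(2) by auto
        then show ?thesis using ab by simp
      qed
    qed
  qed
qed

section \<open>Domains with radial normals are balls\<close>

text \<open>Since \<open>u \<bullet> v = 1 - (norm (u - v))\<^sup>2 / 2\<close> for unit vectors, the bound and its mirror image
  make \<open>G u - G v\<close> of second order in \<open>u - v\<close>. Hence the extension of \<open>G\<close> that is constant on rays
  has derivative zero on the punctured space, which is connected.\<close>
lemma const_on_sphere_if_cos_bound:
  fixes G :: "'a::euclidean_space \<Rightarrow> real"
  assumes dim: "2 \<le> DIM('a)"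
    and nonneg: "\<And>u. norm u = 1 \<Longrightarrow> 0 \<le> G u"
    and cos: "\<And>u v. norm u = 1 \<Longrightarrow> norm v = 1 \<Longrightarrow> G u * (u \<bullet> v) \<le> G v"
    and "norm u = 1" "norm v = 1"
  shows "G u = G v"
proof -
  have der: "((\<lambda>y. G (sgn y)) has_derivative (\<lambda>_. 0)) (at y)" if "y \<in> - {0}" for y :: 'a
  proof (rule has_derivativeI_sandwich)
    define C where "C = 4 * G (sgn y) / (norm y)\<^sup>2"
    have y: "0 < norm y" using that by simp
    show "0 < norm y / 2" using y by simp
    show "norm (G (sgn z) - G (sgn y) - 0) / norm (z - y) \<le> C * norm (z - y)"
      if z: "z \<noteq> y" "dist z y < norm y / 2" for z
    proof -
      have z0: "0 < norm z" using z y by (auto simp: dist_norm)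
      define a b where "a = sgn y" and "b = sgn z"
      have ab: "norm a = 1" "norm b = 1" using y z0 by (auto simp: a_def b_def norm_sgn)
      have "norm y *\<^sub>R (a - b) = (y - z) - (norm y - norm z) *\<^sub>R b"
        using y z0 by (simp add: a_def b_def sgn_div_norm algebra_simps)
      then have "norm y * norm (a - b) = norm ((y - z) - (norm y - norm z) *\<^sub>R b)"
        by (metis norm_scaleR abs_norm_cancel)
      also have "\<dots> \<le> norm (y - z) + \<bar>norm y - norm z\<bar>"
        using norm_triangle_ineq4[of "y - z" "(norm y - norm z) *\<^sub>R b"] ab by simp
      also have "\<dots> \<le> 2 * norm (z - y)"
        using norm_triangle_ineq3[of y z] by (simp add: norm_minus_commute)
      finally have d: "norm (a - b) \<le> 2 * norm (z - y) / norm y"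
        using y by (simp add: field_simps)
      also have "\<dots> \<le> 1" using z(2) y by (simp add: dist_norm field_simps)
      finally have d1: "(norm (a - b))\<^sup>2 \<le> 1" by (simp add: power_le_one)
      have k: "1 - a \<bullet> b = (norm (a - b))\<^sup>2 / 2"
        using ab by (simp add: power2_norm_eq_inner algebra_simps inner_commute norm_eq_1)
      have G: "0 \<le> G a" "0 \<le> G b" "G a * (a \<bullet> b) \<le> G b" "G b * (a \<bullet> b) \<le> G a"
        using nonneg cos[of a b] cos[of b a] ab by (auto simp: inner_commute)
      have "G b * (1/2) \<le> G b * (a \<bullet> b)" using k d1 G by (intro mult_left_mono) auto
      then have Gb: "G b \<le> 2 * G a" using G by linarith
      have k0: "0 \<le> 1 - a \<bullet> b" unfolding k by simp
      have "G b - G a \<le> G b * (1 - a \<bullet> b)" using G by (simp add: algebra_simps)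
      also have "\<dots> \<le> 2 * G a * (1 - a \<bullet> b)" using Gb k0 by (rule mult_right_mono)
      finally have up: "G b - G a \<le> 2 * G a * (1 - a \<bullet> b)" .
      have "G a - G b \<le> G a * (1 - a \<bullet> b)" using G by (simp add: algebra_simps)
      also have "\<dots> \<le> 2 * G a * (1 - a \<bullet> b)" using G k0 by (intro mult_right_mono) auto
      finally have "\<bar>G b - G a\<bar> \<le> 2 * G a * (1 - a \<bullet> b)" using up by linarith
      also have "\<dots> = G a * (norm (a - b))\<^sup>2" unfolding k by simp
      also have "\<dots> \<le> G a * (2 * norm (z - y) / norm y)\<^sup>2"
        using d G(1) by (intro mult_left_mono power_mono) auto
      also have "\<dots> = C * norm (z - y) * norm (z - y)"
        by (simp add: C_def a_def power2_eq_square)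
      finally show ?thesis using z(1) by (simp add: a_def b_def divide_le_eq)
    qed
    have "((\<lambda>z. C * norm (z - y)) \<longlongrightarrow> C * norm (y - y)) (at y)" by (intro tendsto_intros)
    then show "((\<lambda>z. C * norm (z - y)) \<longlongrightarrow> 0) (at y)" by simp
  qed simp
  have "G (sgn u) = G (sgn v)"
    using assms by (intro has_derivative_zero_unique_connected[OF _ connected_punctured_universe[OF dim, of 0] der]) auto
  then show ?thesis using assms by (simp add: sgn_div_norm)
qed

text \<open>The signed distances \<open>(p - c) \<bullet> e\<close> and \<open>(q - c) \<bullet> f\<close> from \<open>c\<close> along the two normals are
  compared by testing the supporting inequality of \<open>p\<close> at the point \<open>q\<close>.\<close>
lemma radial_normals_inequality:
  assumes p: "p \<in> frontier D" "outer_normal D p e" "c - p \<in> span {e}"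
    and q: "q \<in> frontier D" "outer_normal D q f" "c - q \<in> span {f}"
  shows "((q - c) \<bullet> f) * (e \<bullet> f) \<le> (p - c) \<bullet> e"
    and "p = c + ((p - c) \<bullet> e) *\<^sub>R e"
proof -
  have line: "x = c + ((x - c) \<bullet> m) *\<^sub>R m" if xm: "c - x \<in> span {m}" "norm m = 1" for x m
  proof -
    obtain k where k: "c - x = k *\<^sub>R m" using xm(1) unfolding span_singleton by blast
    have "x - c = (- k) *\<^sub>R m" using arg_cong[OF k, of uminus] by simp
    then have x: "x = c + (- k) *\<^sub>R m" and "(x - c) \<bullet> m = - k"
      using xm(2) by (simp_all add: diff_eq_eq norm_eq_1)
    then show ?thesis by simp
  qed
  show pe: "p = c + ((p - c) \<bullet> e) *\<^sub>R e" using line p outer_normal_norm by blast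
  have qf: "q = c + ((q - c) \<bullet> f) *\<^sub>R f" using line q outer_normal_norm by blast
  have "q \<in> closure D" using q(1) by (simp add: frontier_def)
  then have "(q - p) \<bullet> e \<le> 0" by (rule outer_normal_le[OF p(2)])
  then have "(q - c) \<bullet> e \<le> (p - c) \<bullet> e" by (simp add: inner_diff_left)
  moreover have "(q - c) \<bullet> e = ((q - c) \<bullet> f) * (e \<bullet> f)"
  proof -
    have "q - c = ((q - c) \<bullet> f) *\<^sub>R f" using qf by (metis add_diff_cancel_left')
    then show ?thesis by (metis inner_scaleR_left inner_commute)
  qed
  ultimately show "((q - c) \<bullet> f) * (e \<bullet> f) \<le> (p - c) \<bullet> e" by simp
qed

text \<open>Suppose the signed distance at \<open>p\<close> is at most zero. Comparing it with the one at another
  boundary point \<open>q\<close> whose normal \<open>f\<close> makes an acute angle with \<open>e\<close>, in both directions, forces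
  \<open>q = p\<close>. Such a \<open>q\<close> does exist: it is where the ray in direction \<open>e\<close> leaves \<open>D\<close>, when it starts
  in \<open>D\<close> at a point off the normal line of \<open>p\<close>.\<close>
lemma radial_normals_outward:
  fixes D :: "'a::euclidean_space set"
  assumes dim: "2 \<le> DIM('a)" and op: "open D" and conv: "convex D" and ne: "D \<noteq> {}"
    and radial: "\<And>r e. r \<in> frontier D \<Longrightarrow> outer_normal D r e \<Longrightarrow> c - r \<in> span {e}"
    and p: "p \<in> frontier D" "outer_normal D p e"
  shows "0 < (p - c) \<bullet> e"
proof (rule ccontr)
  assume "\<not> 0 < (p - c) \<bullet> e"
  then have neg: "(p - c) \<bullet> e \<le> 0" by simp
  have e1: "norm e = 1" using p outer_normal_norm by blast
  obtain w where w: "w \<noteq> 0" "e \<bullet> w = 0"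
    using orthogonal_to_vector_exists[OF dim] unfolding orthogonal_def by metis
  obtain x where x: "x \<in> D" "(x - p) \<bullet> w \<noteq> 0" using open_not_in_hyperplane[OF op ne w(1)] by blast
  \<comment> \<open>The point of the ray that reaches the supporting hyperplane at \<open>p\<close>.\<close>
  define y where "y = x - ((x - p) \<bullet> e) *\<^sub>R e"
  have "(y - p) \<bullet> e = 0" using e1 by (simp add: y_def inner_diff_left norm_eq_1)
  then have "y \<notin> D" using outer_normal_less[OF p(2)] by fastforce
  then obtain t f where t: "x + t *\<^sub>R (y - x) \<in> frontier D"
    "outer_normal D (x + t *\<^sub>R (y - x)) f" "0 < (y - x) \<bullet> f"
    using exit_outer_normal[OF op conv x(1)] by blast
  define q where "q = x + t *\<^sub>R (y - x)"
  have q: "q \<in> frontier D" "outer_normal D q f" using t by (auto simp: q_def)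
  have "0 < - ((x - p) \<bullet> e) * (e \<bullet> f)" using t(3) by (simp add: y_def)
  moreover have "(x - p) \<bullet> e < 0" by (rule outer_normal_less[OF p(2) x(1)])
  ultimately have k: "0 < e \<bullet> f" by (simp add: mult_less_0_iff)
  have "(q - p) \<bullet> w = (x - p) \<bullet> w" using w(2)
    by (simp add: q_def y_def inner_diff_left inner_add_left)
  then have "q \<noteq> p" using x(2) by auto
  note pq = radial_normals_inequality[OF p radial[OF p] q radial[OF q]]
  note qp = radial_normals_inequality[OF q radial[OF q] p radial[OF p]]
  define s s' k where "s = (p - c) \<bullet> e" and "s' = (q - c) \<bullet> f" and "k = e \<bullet> f"
  have ineq: "s' * k \<le> s" "s * k \<le> s'" "s \<le> 0" "0 < k"
    using pq(1) qp(1) neg k by (auto simp: s_def s'_def k_def inner_commute)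
  have "s' \<le> 0" using ineq mult_pos_pos[of s' k] by linarith
  show False
  proof (cases "k = 1")
    case True
    then have "e \<bullet> f = norm e * norm f" using e1 outer_normal_norm[OF q(2)] by (simp add: k_def)
    then have "norm e *\<^sub>R f = norm f *\<^sub>R e" by (simp only: norm_cauchy_schwarz_eq)
    then have "f = e" using e1 outer_normal_norm[OF q(2)] by simp
    moreover have "s = s'" using ineq True by simp
    ultimately have "p = q" using pq(2) qp(2) by (metis s_def s'_def)
    then show False using \<open>q \<noteq> p\<close> by simp
  next
    case False
    have "k \<le> 1" using norm_cauchy_schwarz[of e f] e1 outer_normal_norm[OF q(2)] by (simp add: k_def)
    then have "k < 1" using False by simp
    then have "k * k < 1" using ineq(4) mult_strict_left_mono[of k 1 k] by linarith
    have "s' * k * k \<le> s * k" using ineq by (intro mult_right_mono) auto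
    then have "0 \<le> s' * (1 - k * k)" using ineq(2) by (simp add: algebra_simps)
    then have "0 \<le> s'" using \<open>k * k < 1\<close> by (simp add: zero_le_mult_iff)
    then have "s' = 0" using \<open>s' \<le> 0\<close> by simp
    then have "s = 0" using ineq by simp
    then have "p = q" using pq(2) qp(2) \<open>s' = 0\<close> unfolding s_def s'_def by simp
    then show False using \<open>q \<noteq> p\<close> by simp
  qed
qed

text \<open>Because the normals point away from \<open>c\<close>, the point \<open>c\<close> is on the inner side of all supporting
  hyperplanes and hence in \<open>D\<close>, and every boundary point \<open>p\<close> has the unit vector from \<open>c\<close> to \<open>p\<close>
  as its normal. The reciprocal \<open>G u\<close> of the distance from \<open>c\<close> to the boundary in direction \<open>u\<close>
  (zero if the ray stays in \<open>D\<close>) then satisfies the cosine bound, so it is constant. The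
  reciprocal is used so that unbounded directions need no separate treatment.\<close>
lemma radial_normals_imp_ball:
  fixes D :: "'a::euclidean_space set"
  assumes dim: "2 \<le> DIM('a)" and op: "open D" and conv: "convex D" and ne: "D \<noteq> {}" "D \<noteq> UNIV"
    and radial: "\<And>r e. r \<in> frontier D \<Longrightarrow> outer_normal D r e \<Longrightarrow> c - r \<in> span {e}"
  shows "is_ball D"
proof -
  have out: "0 < (p - c) \<bullet> e" if "p \<in> frontier D" "outer_normal D p e" for p e
    using radial_normals_outward[OF dim op conv ne(1) radial that] .
  have c: "c \<in> D"
  proof (rule ccontr)
    assume "c \<notin> D"
    then obtain p e where "p \<in> frontier D" "outer_normal D p e" "0 \<le> (c - p) \<bullet> e"
      using separating_outer_normal[OF op conv ne(1)] by blast
    then show False using out[of p e] by (simp add: inner_diff_left)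
  qed
  have disj: "x \<notin> D" if "x \<in> frontier D" for x
    using that op by (simp add: frontier_def interior_open)
  define spec where "spec u g \<longleftrightarrow> (g = 0 \<and> (\<forall>t\<ge>0. c + t *\<^sub>R u \<in> D)) \<or> (0 < g \<and> c + (1 / g) *\<^sub>R u \<in> frontier D)"
    for u and g :: real
  have "\<exists>g. spec u g" for u
  proof (cases "\<forall>t\<ge>0. c + t *\<^sub>R u \<in> D")
    case True then show ?thesis unfolding spec_def by blast
  next
    case False
    then obtain t where t: "0 \<le> t" "c + t *\<^sub>R u \<notin> D" by blast
    then have "0 < t" using c by (cases "t = 0") auto
    obtain s where s: "0 < s" "c + s *\<^sub>R (c + t *\<^sub>R u - c) \<in> frontier D"
      using ray_exit[OF op c t(2)] by blast
    then have "spec u (1 / (s * t))" using \<open>0 < t\<close> by (simp add: spec_def)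
    then show ?thesis by blast
  qed
  then obtain G where G: "\<And>u. spec u (G u)" by metis
  have nonneg: "0 \<le> G u" for u using G[of u] by (auto simp: spec_def)
  have cos: "G u * (u \<bullet> v) \<le> G v" if uv: "norm u = 1" "norm v = 1" for u v
  proof (cases "G u = 0")
    case True then show ?thesis using nonneg by simp
  next
    case False
    then have g: "0 < G u" "c + (1 / G u) *\<^sub>R u \<in> frontier D" using G[of u] by (auto simp: spec_def)
    define p where "p = c + (1 / G u) *\<^sub>R u"
    have p: "p \<in> frontier D" using g p_def by simp
    obtain e where e: "outer_normal D p e" using exists_outer_normal[OF op conv p] .
    obtain k where k: "c - p = k *\<^sub>R e" using radial[OF p e] unfolding span_singleton by blast
    have e1: "norm e = 1" using outer_normal_norm[OF e] .
    have "p - c = (- k) *\<^sub>R e" using arg_cong[OF k, of uminus] by simp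
    moreover have "0 < - k" using out[OF p e] \<open>p - c = _\<close> e1 by (simp add: norm_eq_1)
    ultimately have "sgn (p - c) = e" using e1 by (simp add: sgn_div_norm)
    moreover have "sgn (p - c) = u" using g uv by (simp add: p_def sgn_div_norm)
    ultimately have e_u: "e = u" by simp
    have le: "t * (u \<bullet> v) \<le> 1 / G u" if "c + t *\<^sub>R v \<in> closure D" for t
      using outer_normal_le[OF e that] uv by (simp add: e_u p_def inner_diff_left inner_add_left inner_commute[of v u] norm_eq_1)
    show ?thesis
    proof (cases "G v = 0")
      case True
      have "u \<bullet> v \<le> 0"
      proof (rule ccontr)
        assume "\<not> u \<bullet> v \<le> 0"
        then have pos: "0 < u \<bullet> v" by simp
        \<comment> \<open>This point of the ray is twice as far from \<open>c\<close> as the one on the supporting hyperplane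
            at \<open>p\<close>.\<close>
        have "c + (2 / (G u * (u \<bullet> v))) *\<^sub>R v \<in> D"
          using True G[of v] g pos by (auto simp: spec_def)
        then have "2 / (G u * (u \<bullet> v)) * (u \<bullet> v) \<le> 1 / G u" using le closure_subset by blast
        then show False using pos g by (simp add: field_simps)
      qed
      then show ?thesis using g True by (simp add: mult_nonneg_nonpos)
    next
      case False
      then have g': "0 < G v" "c + (1 / G v) *\<^sub>R v \<in> closure D"
        using G[of v] by (auto simp: spec_def frontier_def)
      show ?thesis using le[OF g'(2)] g'(1) g(1) by (simp add: field_simps)
    qed
  qed
  obtain p where p: "p \<in> frontier D" using ne frontier_eq_empty[of D] by auto
  have pc: "p \<noteq> c" using disj[OF p] c by auto
  define g where "g = G (sgn (p - c))"
  have const: "G u = g" if "norm u = 1" for u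
    unfolding g_def using pc that
    by (intro const_on_sphere_if_cos_bound[OF dim nonneg cos]) (auto simp: norm_sgn)
  have "g \<noteq> 0"
  proof
    assume "g = 0"
    then have "c + norm (p - c) *\<^sub>R sgn (p - c) \<in> D"
      using G[of "sgn (p - c)"] by (auto simp: spec_def g_def)
    then show False using disj[OF p] pc by (simp add: sgn_div_norm)
  qed
  then have g: "0 < g" using nonneg g_def by (metis less_eq_real_def)
  have sphere: "c + (1 / g) *\<^sub>R u \<in> frontier D" if "norm u = 1" for u
    using G[of u] const[OF that] g by (auto simp: spec_def)
  have "D = ball c (1 / g)"
  proof (intro equalityI subsetI)
    fix y assume y: "y \<in> D"
    show "y \<in> ball c (1 / g)"
    proof (rule ccontr)
      assume "y \<notin> ball c (1 / g)"
      then have far: "1 / g \<le> norm (y - c)" by (simp add: dist_norm norm_minus_commute)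
      moreover have "0 < 1 / g" using g by simp
      ultimately have n0: "0 < norm (y - c)" by linarith
      define t where "t = (1 / g) / norm (y - c)"
      have t: "0 \<le> t" "t \<le> 1" using far g n0 by (auto simp: t_def divide_le_eq mult.commute)
      have "c + t *\<^sub>R (y - c) \<in> D"
        using convexD_alt[OF conv c y t] by (simp add: algebra_simps)
      moreover have "t *\<^sub>R (y - c) = (1 / g) *\<^sub>R sgn (y - c)" by (simp add: t_def sgn_div_norm divide_inverse mult.commute)
      ultimately show False using disj[OF sphere[of "sgn (y - c)"]] n0 by (simp add: norm_sgn)
    qed
  next
    fix y assume "y \<in> ball c (1 / g)"
    then have near: "norm (y - c) * g < 1" using g by (simp add: dist_norm norm_minus_commute pos_less_divide_eq)
    show "y \<in> D"
    proof (cases "y = c")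
      case False
      define q where "q = c + (1 / g) *\<^sub>R sgn (y - c)"
      have q: "q \<in> closure D" using sphere[of "sgn (y - c)"] False by (simp add: q_def frontier_def norm_sgn)
      define s where "s = norm (y - c) * g"
      have s: "0 < s" "s < 1" using near g False by (auto simp: s_def)
      have "s *\<^sub>R (q - c) = y - c" using g False by (simp add: q_def s_def sgn_div_norm)
      then have "y = q - (1 - s) *\<^sub>R (q - c)" by (simp add: algebra_simps)
      then have "y \<in> interior D"
        using mem_interior_closure_convex_shrink[OF conv _ q, of c "1 - s"] c s op by (simp add: interior_open)
      then show ?thesis using interior_subset by blast
    qed (use c in simp)
  qed
  then show ?thesis unfolding is_ball_def using g by (intro exI[of _ c] exI[of _ "1 / g"]) auto
qed

section \<open>Classification\<close>

proposition disc_domain_classification: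
  assumes dd: "disc_domain D" and nonuniv: "D \<noteq> UNIV"
  shows "is_ball D \<or> is_half_space D \<or> is_slab D"
proof -
  note dim3 = disc_domain_dim[OF dd] and op = disc_domain_open[OF dd]
    and conv = disc_domain_convex[OF dd] and nonempty = disc_domain_nonempty[OF dd]
  obtain p where p: "p \<in> frontier D" using nonempty nonuniv frontier_eq_empty[of D] by auto
  obtain a where a: "outer_normal D p a" using exists_outer_normal[OF op conv p] .
  show ?thesis
  proof (cases "\<forall>q m. q \<in> frontier D \<longrightarrow> outer_normal D q m \<longrightarrow> m = a \<or> m = - a")
    case True
    then show ?thesis
      using parallel_outer_normals_imp_half_space_or_slab[OF op conv nonempty p a] by blast
  next
    case False
    then obtain q m where q: "q \<in> frontier D" "outer_normal D q m" and "m \<noteq> a" "m \<noteq> - a" by blast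
    then have "m \<notin> span {a}" using unit_notin_span outer_normal_norm a by metis
    then obtain c where "\<And>r e. r \<in> frontier D \<Longrightarrow> outer_normal D r e \<Longrightarrow> c - r \<in> span {e}"
      using normal_lines_concurrent[OF dd q p a] by blast
    then show ?thesis using radial_normals_imp_ball[OF _ op conv nonempty nonuniv, of c] dim3 by simp
  qed
qed

text \<open>A ball looks round from \<open>x\<close> with respect to the vector from \<open>x\<close> to its centre, a half-space
  and a slab with respect to their normal vector.\<close>
theorem theorem5p1:
  fixes D :: "(real ^ 'n) set"
  assumes "CARD('n) \<ge> 3"
    and "is_domain D" and "convex D" and "D \<subset> UNIV"
  shows "(\<forall>x\<in>D. \<forall>v. bdry_delta D 1 x v = bdry_delta D (CARD('n) - 1) x v)
    \<longleftrightarrow> is_ball D \<or> is_half_space D \<or> is_slab D"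
proof
  have D: "open D" "D \<noteq> {}" "D \<noteq> UNIV" using assms by (auto simp: is_domain_def)
  have dim: "2 \<le> DIM(real ^ 'n)" using assms(1) by simp
  {
    assume eq: "\<forall>x\<in>D. \<forall>v. bdry_delta D 1 x v = bdry_delta D (CARD('n) - 1) x v"
    have "disc_domain D"
      unfolding disc_domain_def
    proof (intro conjI ballI allI impI)
      fix x v :: "real ^ 'n" and R :: real
      assume "x \<in> D" "v \<noteq> 0" "0 < R" "\<forall>t. norm (t *\<^sub>R v) < R \<longrightarrow> x + t *\<^sub>R v \<in> D"
      then show "\<exists>n. norm n = 1 \<and> n \<bullet> v = 0 \<and> (\<forall>u. n \<bullet> u = 0 \<longrightarrow> norm u < R \<longrightarrow> x + u \<in> closure D)"
        using hyperplane_disc_if_bdry_delta_eq[OF dim D(1), of x v R] eq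
        by (metis DIM_cart DIM_real mult.right_neutral)
    qed (use assms D in simp_all)
    then show "is_ball D \<or> is_half_space D \<or> is_slab D" by (rule disc_domain_classification[OF _ D(3)])
  next
    assume shape: "is_ball D \<or> is_half_space D \<or> is_slab D"
    have "\<exists>w. round_from D x w" for x
      using shape round_from_ball round_from_half_space round_from_slab
      unfolding is_ball_def is_half_space_def is_slab_def by metis
    then show "\<forall>x\<in>D. \<forall>v. bdry_delta D 1 x v = bdry_delta D (CARD('n) - 1) x v"
      using bdry_delta_eq_if_round[OF dim D(1)] by (metis DIM_cart DIM_real mult.right_neutral)
  }
qed

end
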